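(* Let $p\ge2$ be an integer and $R$ an integral domain. (1) Let $r_0,\dots,r_{p-1}$ be indeterminates. The F-series $$X(\mathfrak{z})=\sum_{n=0}^{\infty}r_0^n\prod_{k=1}^{p-1}(r_k/r_0)^{\#_{p:k}([\mathfrak{z}]_{p^n})}$$ (a function $\mathbb{Z}_p\to R[[r_0,\dots,r_{p-1}]]$) is the unique formal solution of the functional equations $$X(p\mathfrak{z}+j)=r_jX(\mathfrak{z})+1,\qquad\forall\mathfrak{z}\in\mathbb{Z}_p,\ \forall j\in\{0,\dots,p-1\}.$$ (2) Let $a_0,\dots,a_{p-1},b_0,\dots,b_{p-1}$ be indeterminates. The F-series $$X(\mathfrak{z})=\sum_{n=0}^{\infty}b_{[\theta_p^{\circ n}(\mathfrak{z})]_p}\,a_0^n\prod_{k=1}^{p-1}(a_k/a_0)^{\#_{p:k}([\mathfrak{z}]_{p^n})}$$ (a function $\mathbb{Z}_p\to R[[a_0,\dots,a_{p-1}]][b_0,\dots,b_{p-1}]$) is the unique formal solution of the functional equations $$X(p\mathfrak{z}+j)=a_jX(\mathfrak{z})+b_j,\qquad\forall\mathfrak{z}\in\mathbb{Z}_p,\ \forall j\in\{0,\dots,p-1\}.$$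
   Context: $\mathbb{Z}_p=\varprojlim\mathbb{Z}/p^n\mathbb{Z}$ (every element has a unique expansion $\sum_{n\ge0}d_np^n$ with $d_n\in\{0,\dots,p-1\}$). $[\mathfrak{z}]_{p^n}\in\{0,\dots,p^n-1\}$ is the integer congruent to $\mathfrak{z}$ mod $p^n$. $\theta_p(\mathfrak{z})=(\mathfrak{z}-[\mathfrak{z}]_p)/p$ is the digit shift and $\theta_p^{\circ n}$ its $n$-fold iterate. For $1\le k\le p-1$, $\#_{p:k}(n)$ is the number of base-$p$ digits of the integer $n\ge0$ equal to $k$. Since the exponent of $r_0$ (resp. $a_0$) in each summand is non-negative, each summand is a monomial (times some $b_k$), and the sums are formal power series. "Formal solution" means a function from $\mathbb{Z}_p$ to the indicated ring of formal power series satisfying the equations. *)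

theory Defs
  imports "HOL-Library.Poly_Mapping" "HOL-Algebra.Ring"
begin

section \<open>The ring of p-adic integers, for an arbitrary integer base\<close>

text \<open>
  The inverse limit of the rings of integers modulo \<open>p ^ n\<close>. An element is a compatible
  sequence \<open>z\<close>, every residue class being represented by its least non-negative element.
  Hence \<open>z n\<close> itself is the integer in \<open>{0..<p ^ n}\<close> congruent to \<open>z\<close> modulo \<open>p ^ n\<close>.
\<close>

definition Zp :: "nat \<Rightarrow> (nat \<Rightarrow> nat) ring" where
  "Zp p =
     \<lparr>carrier = {z. \<forall>n. z n < p ^ n \<and> z (Suc n) mod p ^ n = z n},
      monoid.mult = (\<lambda>x y n. (x n * y n) mod p ^ n),
      one = (\<lambda>n. 1 mod p ^ n),
      zero = (\<lambda>n. 0),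
      add = (\<lambda>x y n. (x n + y n) mod p ^ n)\<rparr>"

definition Zp_of_nat :: "nat \<Rightarrow> nat \<Rightarrow> (nat \<Rightarrow> nat)" where
  "Zp_of_nat p k = (\<lambda>n. k mod p ^ n)"

definition Zp_trunc :: "(nat \<Rightarrow> nat) \<Rightarrow> nat \<Rightarrow> nat" where
  "Zp_trunc z n = z n"

definition Zp_shift :: "nat \<Rightarrow> (nat \<Rightarrow> nat) \<Rightarrow> (nat \<Rightarrow> nat)" where
  "Zp_shift p z =
     (THE w. w \<in> carrier (Zp p) \<and>
        Zp_of_nat p p \<otimes>\<^bsub>Zp p\<^esub> w = z \<ominus>\<^bsub>Zp p\<^esub> Zp_of_nat p (Zp_trunc z 1))"

definition Zp_affine :: "nat \<Rightarrow> nat \<Rightarrow> (nat \<Rightarrow> nat) \<Rightarrow> (nat \<Rightarrow> nat)" where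
  "Zp_affine p j z = (Zp_of_nat p p \<otimes>\<^bsub>Zp p\<^esub> z) \<oplus>\<^bsub>Zp p\<^esub> Zp_of_nat p j"

lemma Zp_mod_mod: "(a::nat) mod p ^ Suc n mod p ^ n = a mod p ^ n"
  by (simp add: mod_mod_cancel)

lemma Zp_carrier_iff:
  "z \<in> carrier (Zp p) \<longleftrightarrow> (\<forall>n. z n < p ^ n \<and> z (Suc n) mod p ^ n = z n)"
  by (simp add: Zp_def)

lemma Zp_carrierI:
  assumes "0 < p" and "\<And>n. z n = f n mod p ^ n" and "\<And>n. f (Suc n) mod p ^ n = f n mod p ^ n"
  shows "z \<in> carrier (Zp p)"
  using assms by (simp add: Zp_carrier_iff mod_mod_cancel)

lemma Zp_mod_self: "z \<in> carrier (Zp p) \<Longrightarrow> z n mod p ^ n = z n"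
  by (simp add: Zp_carrier_iff)

lemma Zp_cring:
  assumes p: "0 < p"
  shows "cring (Zp p)"
proof (rule cringI)
  have S: "z (Suc n) mod p ^ n = z n mod p ^ n" if "z \<in> carrier (Zp p)" for z n
    using that by (simp add: Zp_carrier_iff)
  have add_closed: "x \<oplus>\<^bsub>Zp p\<^esub> y \<in> carrier (Zp p)"
    if "x \<in> carrier (Zp p)" "y \<in> carrier (Zp p)" for x y
    by (rule Zp_carrierI[OF p, where f = "\<lambda>n. x n + y n"])
      (use S[OF that(1)] S[OF that(2)] in \<open>auto simp: Zp_def intro: mod_add_cong\<close>)
  have mult_closed: "x \<otimes>\<^bsub>Zp p\<^esub> y \<in> carrier (Zp p)"
    if "x \<in> carrier (Zp p)" "y \<in> carrier (Zp p)" for x y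
    by (rule Zp_carrierI[OF p, where f = "\<lambda>n. x n * y n"])
      (use S[OF that(1)] S[OF that(2)] in \<open>auto simp: Zp_def intro: mod_mult_cong\<close>)
  show "abelian_group (Zp p)"
  proof (rule abelian_groupI)
    fix x assume x: "x \<in> carrier (Zp p)"
    show "\<exists>y\<in>carrier (Zp p). y \<oplus>\<^bsub>Zp p\<^esub> x = \<zero>\<^bsub>Zp p\<^esub>"
    proof
      let ?y = "\<lambda>n. (p ^ n - x n) mod p ^ n"
      have lt: "x n \<le> p ^ n" for n using x by (simp add: Zp_carrier_iff less_imp_le)
      have 0: "(?y n + x n) mod p ^ n = 0" for n
        using lt[of n] by (simp add: mod_add_left_eq)
      show "?y \<in> carrier (Zp p)"
      proof (rule Zp_carrierI[OF p, where f = "\<lambda>n. p ^ n - x n"])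
        fix n
        have "int ((p ^ Suc n - x (Suc n)) mod p ^ n) = (- int (x (Suc n))) mod int (p ^ n)"
          using lt[of "Suc n"] by (simp add: of_nat_mod of_nat_diff mod_diff_eq
              flip: mod_diff_left_eq)
        also have "\<dots> = (- int (x n)) mod int (p ^ n)"
          using x by (metis Zp_carrier_iff mod_minus_eq of_nat_mod)
        also have "\<dots> = int ((p ^ n - x n) mod p ^ n)"
          using lt[of "n"] by (simp add: of_nat_mod of_nat_diff flip: mod_diff_left_eq)
        finally show "(p ^ Suc n - x (Suc n)) mod p ^ n = (p ^ n - x n) mod p ^ n"
          by linarith
      qed simp
      show "?y \<oplus>\<^bsub>Zp p\<^esub> x = \<zero>\<^bsub>Zp p\<^esub>"
        unfolding Zp_def by (simp add: 0)
    qed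
  next
    fix x assume "x \<in> carrier (Zp p)"
    then show "\<zero>\<^bsub>Zp p\<^esub> \<oplus>\<^bsub>Zp p\<^esub> x = x"
      using Zp_mod_self by (auto simp: Zp_def)
  next
    fix x y z assume "x \<in> carrier (Zp p)" "y \<in> carrier (Zp p)" "z \<in> carrier (Zp p)"
    show "(x \<oplus>\<^bsub>Zp p\<^esub> y) \<oplus>\<^bsub>Zp p\<^esub> z = x \<oplus>\<^bsub>Zp p\<^esub> (y \<oplus>\<^bsub>Zp p\<^esub> z)"
      by (simp add: Zp_def mod_add_left_eq mod_add_right_eq add.assoc)
  qed (use p add_closed in \<open>auto simp: Zp_def add.commute\<close>)
  show "comm_monoid (Zp p)"
  proof (rule comm_monoidI)
    show "\<one>\<^bsub>Zp p\<^esub> \<in> carrier (Zp p)"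
      by (rule Zp_carrierI[OF p, where f = "\<lambda>n. 1"]) (simp_all add: Zp_def)
    fix x y z
    show "(x \<otimes>\<^bsub>Zp p\<^esub> y) \<otimes>\<^bsub>Zp p\<^esub> z = x \<otimes>\<^bsub>Zp p\<^esub> (y \<otimes>\<^bsub>Zp p\<^esub> z)"
      by (simp add: Zp_def mod_mult_left_eq mod_mult_right_eq mult.assoc)
    assume x: "x \<in> carrier (Zp p)"
    show "\<one>\<^bsub>Zp p\<^esub> \<otimes>\<^bsub>Zp p\<^esub> x = x"
    proof
      fix n
      have "(\<one>\<^bsub>Zp p\<^esub> \<otimes>\<^bsub>Zp p\<^esub> x) n = (1 * x n) mod p ^ n"
        unfolding Zp_def by (simp only: monoid.simps partial_object.simps mod_mult_left_eq)
      then show "(\<one>\<^bsub>Zp p\<^esub> \<otimes>\<^bsub>Zp p\<^esub> x) n = x n"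
        using Zp_mod_self[OF x] by simp
    qed
  qed (use mult_closed in \<open>auto simp: Zp_def mult.commute\<close>)
  fix x y z
  show "(x \<oplus>\<^bsub>Zp p\<^esub> y) \<otimes>\<^bsub>Zp p\<^esub> z = x \<otimes>\<^bsub>Zp p\<^esub> z \<oplus>\<^bsub>Zp p\<^esub> y \<otimes>\<^bsub>Zp p\<^esub> z"
    by (simp add: Zp_def mod_mult_left_eq mod_add_eq distrib_right)
qed

lemma Zp_of_nat_closed: "0 < p \<Longrightarrow> Zp_of_nat p k \<in> carrier (Zp p)"
  by (simp add: Zp_of_nat_def Zp_carrier_iff mod_mod_cancel)

lemma Zp_affine_closed:
  assumes "0 < p" and "z \<in> carrier (Zp p)"
  shows "Zp_affine p j z \<in> carrier (Zp p)"
proof -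
  interpret cring "Zp p" by (rule Zp_cring[OF assms(1)])
  show ?thesis
    by (simp add: Zp_affine_def Zp_of_nat_closed assms)
qed

lemma Zp_affine_apply: "Zp_affine p j z n = (p * z n + j) mod p ^ n"
  by (simp add: Zp_affine_def Zp_def Zp_of_nat_def mod_add_eq mod_mult_left_eq)

lemma Zp_mult_p_cancel:
  assumes "0 < p" and "v \<in> carrier (Zp p)" and "w \<in> carrier (Zp p)"
    and "Zp_of_nat p p \<otimes>\<^bsub>Zp p\<^esub> v = Zp_of_nat p p \<otimes>\<^bsub>Zp p\<^esub> w"
  shows "v = w"
proof
  fix n
  have "(p * v (Suc n)) mod p ^ Suc n = (p * w (Suc n)) mod p ^ Suc n"
    using fun_cong[OF assms(4), of "Suc n"] by (simp add: Zp_def Zp_of_nat_def mod_mult_left_eq)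
  then have "v (Suc n) mod p ^ n = w (Suc n) mod p ^ n"
    using assms(1) by (simp flip: mult_mod_right)
  then show "v n = w n"
    using assms(2,3) by (simp add: Zp_carrier_iff)
qed

text \<open>The description defining \<^const>\<open>Zp_shift\<close> is met by exactly one element: \<open>z\<close> with its
  lowest digit removed.\<close>

lemma Zp_shift_spec:
  assumes p: "0 < p" and z: "z \<in> carrier (Zp p)"
  defines "w \<equiv> \<lambda>n. z (Suc n) div p"
  shows "w \<in> carrier (Zp p)"
    and "Zp_of_nat p p \<otimes>\<^bsub>Zp p\<^esub> w = z \<ominus>\<^bsub>Zp p\<^esub> Zp_of_nat p (Zp_trunc z 1)"
    and "Zp_shift p z = w"
proof -
  interpret cring "Zp p" by (rule Zp_cring[OF p])
  have z': "z n < p ^ n" "z (Suc n) mod p ^ n = z n" for n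
    using z by (auto simp: Zp_carrier_iff)
  have z1: "z (Suc n) mod p = z 1" for n
  proof (induction n)
    case (Suc n)
    have "z (Suc (Suc n)) mod p = z (Suc (Suc n)) mod p ^ Suc n mod p"
      by (rule sym, rule mod_mod_cancel) simp
    also have "\<dots> = z (Suc n) mod p" by (simp only: z'(2))
    finally show ?case using Suc by simp
  qed (use z'(1)[of 1] in simp)
  show w: "w \<in> carrier (Zp p)"
    unfolding Zp_carrier_iff
  proof (intro allI conjI)
    fix n
    show "w n < p ^ n"
      using z'(1)[of "Suc n"] p by (simp add: w_def less_mult_imp_div_less mult.commute)
    have "w (Suc n) mod p ^ n = z (Suc (Suc n)) mod (p * p ^ n) div p"
      using p by (simp add: w_def mod_mult2_eq)
    then show "w (Suc n) mod p ^ n = w n"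
      using z'(2)[of "Suc n"] by (simp add: w_def)
  qed
  let ?c = "Zp_of_nat p (Zp_trunc z 1)" and ?P = "Zp_of_nat p p"
  have "(?P \<otimes>\<^bsub>Zp p\<^esub> w) \<oplus>\<^bsub>Zp p\<^esub> ?c = z"
  proof
    fix n
    have "((?P \<otimes>\<^bsub>Zp p\<^esub> w) \<oplus>\<^bsub>Zp p\<^esub> ?c) n = (p * w n + z 1) mod p ^ n"
      by (simp add: Zp_def Zp_of_nat_def Zp_trunc_def mod_add_eq mod_mult_left_eq)
    also have "p * w n + z 1 = z (Suc n)"
      using z1[of n] by (metis w_def mult_div_mod_eq)
    finally show "((?P \<otimes>\<^bsub>Zp p\<^esub> w) \<oplus>\<^bsub>Zp p\<^esub> ?c) n = z n" by (simp add: z')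
  qed
  moreover have "?c \<in> carrier (Zp p)" "?P \<in> carrier (Zp p)"
    using p by (auto intro: Zp_of_nat_closed)
  ultimately show eq: "?P \<otimes>\<^bsub>Zp p\<^esub> w = z \<ominus>\<^bsub>Zp p\<^esub> ?c"
    using w by (metis a_minus_def add.inv_solve_right m_closed z)
  show "Zp_shift p z = w"
    unfolding Zp_shift_def
    by (rule the_equality) (use w eq Zp_mult_p_cancel[OF p] in auto)
qed


section \<open>Digits and the monomials of an F-series\<close>

definition digit_count :: "nat \<Rightarrow> nat \<Rightarrow> nat \<Rightarrow> nat" where
  "digit_count p k n = card {i. n div p ^ i mod p = k}"

text \<open>
  The monomial \<open>x\<^sub>0 ^ n * (\<Prod>k = 1..p - 1. (x\<^sub>k / x\<^sub>0) ^ digit_count p k m)\<close>, with the powers of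
  \<open>x\<^sub>0\<close> collected. For \<open>m < p ^ n\<close> the subtraction in the exponent is not truncated, see
  \<open>sum_digit_count_le\<close> below.
\<close>

definition digit_monomial :: "nat \<Rightarrow> (nat \<Rightarrow> 'b::comm_ring_1) \<Rightarrow> nat \<Rightarrow> nat \<Rightarrow> 'b" where
  "digit_monomial p x n m =
     x 0 ^ (n - (\<Sum>k = 1..p - 1. digit_count p k m)) * (\<Prod>k = 1..p - 1. x k ^ digit_count p k m)"

lemma sum_digit_count_le:
  assumes "m < p ^ n"
  shows "(\<Sum>k = 1..p - 1. digit_count p k m) \<le> n"
proof -
  let ?D = "\<lambda>k. {i. m div p ^ i mod p = k}"
  have sub: "?D k \<subseteq> {..<n}" if "k \<in> {1..p - 1}" for k
  proof
    fix i assume i: "i \<in> ?D k"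
    have "i < n"
    proof (rule ccontr)
      assume "\<not> i < n"
      then have "p ^ n \<le> p ^ i" using that by (intro power_increasing) auto
      then have "m div p ^ i = 0" using assms by simp
      then show False using i that by simp
    qed
    then show "i \<in> {..<n}" by simp
  qed
  have "(\<Sum>k = 1..p - 1. digit_count p k m) = card (\<Union>k\<in>{1..p - 1}. ?D k)"
    unfolding digit_count_def
  proof (rule card_UN_disjoint[symmetric])
    show "\<forall>k\<in>{1..p - 1}. finite (?D k)"
      using sub finite_subset[OF _ finite_lessThan] by meson
  qed auto
  also have "\<dots> \<le> card {..<n}"
  proof (rule card_mono)
    show "(\<Union>k\<in>{1..p - 1}. ?D k) \<subseteq> {..<n}"
      by (rule UN_least) (rule sub)
  qed simp
  finally show ?thesis by simp
qed

lemma digit_monomial_mult: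
  assumes "m < p ^ n"
  shows "digit_monomial p x n m * (\<Prod>k = 1..p - 1. x 0 ^ digit_count p k m) =
         x 0 ^ n * (\<Prod>k = 1..p - 1. x k ^ digit_count p k m)"
proof -
  let ?s = "\<Sum>k = 1..p - 1. digit_count p k m"
  have "x 0 ^ (n - ?s) * (\<Prod>k = 1..p - 1. x 0 ^ digit_count p k m) = x 0 ^ n"
    using sum_digit_count_le[OF assms]
    by (simp add: power_add[symmetric] power_sum[symmetric])
  then have "x 0 ^ (n - ?s) * q * (\<Prod>k = 1..p - 1. x 0 ^ digit_count p k m) = x 0 ^ n * q" for q
    by (simp only: mult.assoc[of _ q] mult.commute[of q] flip: mult.assoc)
  then show ?thesis
    unfolding digit_monomial_def .
qed


section \<open>Formal power series in several variables\<close>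

text \<open>
  The variables are indexed by the natural numbers; exponents are finitely supported. The ring of
  power series in the first \<open>p\<close> variables is the subring \<open>mfps_ring p\<close>.
\<close>

typedef 'a mfps = "UNIV :: ((nat \<Rightarrow>\<^sub>0 nat) \<Rightarrow> 'a) set"
  morphisms mfps_coeff Abs_mfps ..

setup_lifting type_definition_mfps

lemma mfps_eqI: "(\<And>m. mfps_coeff f m = mfps_coeff g m) \<Longrightarrow> f = g"
  by (metis ext mfps_coeff_inject)

lemma finite_exponent_splits: "finite {(s, t). s + t = (m :: nat \<Rightarrow>\<^sub>0 nat)}"
proof -
  let ?L = "Poly_Mapping.lookup" and ?K = "Poly_Mapping.keys m"
  let ?A = "{s. \<exists>t. s + t = m}"
  have "finite ?A"
  proof (rule inj_on_finite)
    have z: "?L s i = 0" if "s \<in> ?A" "i \<notin> ?K" for s i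
      using that by (auto simp: lookup_add in_keys_iff)
    show "inj_on (\<lambda>s. restrict (?L s) ?K) ?A"
    proof (rule inj_onI)
      fix s t assume st: "s \<in> ?A" "t \<in> ?A" "restrict (?L s) ?K = restrict (?L t) ?K"
      show "s = t"
      proof (rule poly_mapping_eqI)
        fix i show "?L s i = ?L t i"
          using st z by (cases "i \<in> ?K") (auto dest!: fun_cong[where x = i])
      qed
    qed
    show "(\<lambda>s. restrict (?L s) ?K) ` ?A \<subseteq> (\<Pi>\<^sub>E i\<in>?K. {..?L m i})"
      by (auto simp: lookup_add)
    show "finite (\<Pi>\<^sub>E i\<in>?K. {..?L m i})"
      by (intro finite_PiE) auto
  qed
  moreover have "(s, t) \<in> ?A \<times> ?A" if "s + t = m" for s t
    using that add.commute[of t s] by auto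
  then have "{(s, t). s + t = m} \<subseteq> ?A \<times> ?A" by blast
  ultimately show ?thesis
    by (meson finite_SigmaI finite_subset)
qed

instantiation mfps :: (comm_ring_1) comm_ring_1
begin

lift_definition zero_mfps :: "'a mfps" is "\<lambda>m. 0" .

lift_definition one_mfps :: "'a mfps" is "\<lambda>m. if m = 0 then 1 else 0" .

lift_definition plus_mfps :: "'a mfps \<Rightarrow> 'a mfps \<Rightarrow> 'a mfps" is "\<lambda>f g m. f m + g m" .

lift_definition minus_mfps :: "'a mfps \<Rightarrow> 'a mfps \<Rightarrow> 'a mfps" is "\<lambda>f g m. f m - g m" .

lift_definition uminus_mfps :: "'a mfps \<Rightarrow> 'a mfps" is "\<lambda>f m. - f m" .

lift_definition times_mfps :: "'a mfps \<Rightarrow> 'a mfps \<Rightarrow> 'a mfps" is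
  "\<lambda>f g m. \<Sum>(s, t) | s + t = m. f s * g t" .

instance
proof
  fix f g h :: "'a mfps"
  show "f * g * h = f * (g * h)"
  proof (transfer, rule ext)
    fix f g h :: "(nat \<Rightarrow>\<^sub>0 nat) \<Rightarrow> 'a" and m
    let ?S = "\<lambda>m. {(s, t). s + t = (m :: nat \<Rightarrow>\<^sub>0 nat)}"
    have "(\<Sum>(s, t)\<in>?S m. (\<Sum>(u, v)\<in>?S s. f u * g v) * h t) =
        (\<Sum>(x, y)\<in>(SIGMA x:?S m. ?S (fst x)). f (fst y) * g (snd y) * h (snd x))"
      by (subst sum.Sigma[symmetric])
        (use finite_exponent_splits in \<open>auto simp: sum_distrib_right intro!: sum.cong\<close>)
    also have "\<dots> = (\<Sum>(x, y)\<in>(SIGMA x:?S m. ?S (snd x)). f (fst x) * (g (fst y) * h (snd y)))"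
      by (rule sum.reindex_bij_witness[where
            j = "\<lambda>((s, t), (u, v)). ((u, v + t), (v, t))" and
            i = "\<lambda>((s, t), (u, v)). ((s + u, v), (s, u))"])
        (auto simp: add.assoc mult.assoc)
    also have "\<dots> = (\<Sum>(s, t)\<in>?S m. f s * (\<Sum>(u, v)\<in>?S t. g u * h v))"
      by (subst sum.Sigma[symmetric])
        (use finite_exponent_splits in \<open>auto simp: sum_distrib_left intro!: sum.cong\<close>)
    finally show "(\<Sum>(s, t)\<in>?S m. (\<Sum>(u, v)\<in>?S s. f u * g v) * h t) =
        (\<Sum>(s, t)\<in>?S m. f s * (\<Sum>(u, v)\<in>?S t. g u * h v))" .
  qed
  show "f * g = g * f"
  proof (transfer, rule ext)
    fix f g :: "(nat \<Rightarrow>\<^sub>0 nat) \<Rightarrow> 'a" and m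
    show "(\<Sum>(s, t) | s + t = m. f s * g t) = (\<Sum>(s, t) | s + t = m. g s * f t)"
      by (rule sum.reindex_bij_witness[where i = prod.swap and j = prod.swap])
        (auto simp: add.commute mult.commute)
  qed
  show "1 * f = f"
  proof (transfer, rule ext)
    fix f :: "(nat \<Rightarrow>\<^sub>0 nat) \<Rightarrow> 'a" and m
    have "(\<Sum>(s, t) | s + t = m. (if s = 0 then 1 else 0) * f t) =
        (\<Sum>(s, t)\<in>{(0 :: nat \<Rightarrow>\<^sub>0 nat, m)}. (if s = 0 then 1 else 0) * f t)"
      by (rule sum.mono_neutral_right) (auto simp: finite_exponent_splits split: if_splits)
    then show "(\<Sum>(s, t) | s + t = m. (if s = 0 then 1 else 0) * f t) = f m"
      by simp
  qed
  show "(f + g) * h = f * h + g * h"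
    by (transfer, rule ext) (simp add: split_def distrib_right sum.distrib)
  show "(0::'a mfps) \<noteq> 1"
    by transfer (auto dest: fun_cong[where x = 0])
qed (transfer, simp add: algebra_simps fun_eq_iff)+

end

lift_definition mfps_var :: "nat \<Rightarrow> 'a::comm_ring_1 mfps" is
  "\<lambda>i m. if m = Poly_Mapping.single i 1 then 1 else 0" .

definition mfps_ring :: "nat \<Rightarrow> 'a::comm_ring_1 mfps set" where
  "mfps_ring p = {f. \<forall>m. mfps_coeff f m \<noteq> 0 \<longrightarrow> Poly_Mapping.keys m \<subseteq> {..<p}}"

text \<open>Every coefficient of the partial sums is eventually constant, i.e. convergence for the
  product topology with discrete coefficients.\<close>

definition mfps_sums :: "(nat \<Rightarrow> 'a::comm_ring_1 mfps) \<Rightarrow> 'a mfps \<Rightarrow> bool" where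
  "mfps_sums f S \<longleftrightarrow>
     (\<forall>m. \<forall>\<^sub>F N in sequentially. mfps_coeff (\<Sum>n<N. f n) m = mfps_coeff S m)"

definition mfps_suminf :: "(nat \<Rightarrow> 'a::comm_ring_1 mfps) \<Rightarrow> 'a mfps" where
  "mfps_suminf f = (THE S. mfps_sums f S)"

lemma mfps_sums_unique:
  assumes "mfps_sums f S" and "mfps_sums f T"
  shows "S = T"
proof (rule mfps_eqI)
  fix m
  have "\<forall>\<^sub>F N in sequentially. mfps_coeff S m = mfps_coeff T m"
    by (rule eventually_elim2[OF assms[unfolded mfps_sums_def, THEN spec, of m]]) simp
  then show "mfps_coeff S m = mfps_coeff T m" by simp
qed


section \<open>Polynomials over formal power series\<close>

text \<open>
  The outer polynomial mapping holds the exponents of \<open>b\<^sub>0, b\<^sub>1, \<dots>\<close>, its coefficients are power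
  series in \<open>a\<^sub>0, a\<^sub>1, \<dots>\<close>. Again \<open>mfps_poly_ring p\<close> is the subring in which only the variables
  with index below \<open>p\<close> occur.
\<close>

type_synonym 'a mfps_poly = "(nat \<Rightarrow>\<^sub>0 nat) \<Rightarrow>\<^sub>0 'a mfps"

definition mfps_poly_ring :: "nat \<Rightarrow> 'a::comm_ring_1 mfps_poly set" where
  "mfps_poly_ring p =
     {P. \<forall>m \<in> Poly_Mapping.keys P.
           Poly_Mapping.keys m \<subseteq> {..<p} \<and> Poly_Mapping.lookup P m \<in> mfps_ring p}"

definition a_var :: "nat \<Rightarrow> 'a::comm_ring_1 mfps_poly" where
  "a_var i = Poly_Mapping.single 0 (mfps_var i)"

definition b_var :: "nat \<Rightarrow> 'a::comm_ring_1 mfps_poly" where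
  "b_var i = Poly_Mapping.single (Poly_Mapping.single i 1) 1"

definition mfps_poly_sums :: "(nat \<Rightarrow> 'a::comm_ring_1 mfps_poly) \<Rightarrow> 'a mfps_poly \<Rightarrow> bool" where
  "mfps_poly_sums f S \<longleftrightarrow>
     (\<forall>m. mfps_sums (\<lambda>n. Poly_Mapping.lookup (f n) m) (Poly_Mapping.lookup S m))"

definition mfps_poly_suminf :: "(nat \<Rightarrow> 'a::comm_ring_1 mfps_poly) \<Rightarrow> 'a mfps_poly" where
  "mfps_poly_suminf f = (THE S. mfps_poly_sums f S)"

lemma mfps_poly_sums_unique: "mfps_poly_sums f S \<Longrightarrow> mfps_poly_sums f T \<Longrightarrow> S = T"
  by (auto simp: mfps_poly_sums_def intro!: poly_mapping_eqI mfps_sums_unique)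


section \<open>The two F-series and their functional equations\<close>

definition F_term :: "nat \<Rightarrow> (nat \<Rightarrow> nat) \<Rightarrow> nat \<Rightarrow> 'a::comm_ring_1 mfps" where
  "F_term p z n = digit_monomial p mfps_var n (Zp_trunc z n)"

definition F_series :: "nat \<Rightarrow> (nat \<Rightarrow> nat) \<Rightarrow> 'a::comm_ring_1 mfps" where
  "F_series p z = mfps_suminf (F_term p z)"

definition F_solution :: "nat \<Rightarrow> ((nat \<Rightarrow> nat) \<Rightarrow> 'a::comm_ring_1 mfps) \<Rightarrow> bool" where
  "F_solution p X \<longleftrightarrow>
     X \<in> carrier (Zp p) \<rightarrow> mfps_ring p \<and>
     (\<forall>z \<in> carrier (Zp p). \<forall>j \<in> {0..p - 1}.
        X (Zp_affine p j z) = mfps_var j * X z + 1)"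

definition F_term_ab :: "nat \<Rightarrow> (nat \<Rightarrow> nat) \<Rightarrow> nat \<Rightarrow> 'a::comm_ring_1 mfps_poly" where
  "F_term_ab p z n =
     b_var (Zp_trunc ((Zp_shift p ^^ n) z) 1) * digit_monomial p a_var n (Zp_trunc z n)"

definition F_series_ab :: "nat \<Rightarrow> (nat \<Rightarrow> nat) \<Rightarrow> 'a::comm_ring_1 mfps_poly" where
  "F_series_ab p z = mfps_poly_suminf (F_term_ab p z)"

definition F_solution_ab :: "nat \<Rightarrow> ((nat \<Rightarrow> nat) \<Rightarrow> 'a::comm_ring_1 mfps_poly) \<Rightarrow> bool" where
  "F_solution_ab p X \<longleftrightarrow>
     X \<in> carrier (Zp p) \<rightarrow> mfps_poly_ring p \<and>
     (\<forall>z \<in> carrier (Zp p). \<forall>j \<in> {0..p - 1}.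
        X (Zp_affine p j z) = a_var j * X z + b_var j)"

end

theory Submission
  imports Defs
begin

text \<open>
  Every \<open>p\<close>-adic integer is \<open>p * w + j\<close> for exactly one digit \<open>j\<close> and one \<open>w\<close>, and prepending the
  digit \<open>j\<close> multiplies the monomials of the F-series by the variable \<open>x\<^sub>j\<close>: the monomial of index
  \<open>n + 1\<close> at \<open>p * w + j\<close> is \<open>x\<^sub>j\<close> times the monomial of index \<open>n\<close> at \<open>w\<close> (\<open>F_term_affine\<close>, which rests
  on \<open>digit_monomial_step\<close>). Each part of the theorem is a consequence.

  Convergence: by induction on \<open>n\<close> the \<open>n\<close>-th monomial is homogeneous of degree \<open>n\<close>, so every
  coefficient of the series is influenced by a single term (\<open>mfps_sums_homogeneous\<close>).

  Functional equation: dropping the term of index \<open>0\<close> from the series at \<open>p * w + j\<close> leaves \<open>x\<^sub>j\<close>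
  times the series at \<open>w\<close>, and the dropped term is \<open>1\<close>, respectively \<open>b\<^sub>j\<close>.

  Uniqueness: the difference \<open>D\<close> of two solutions satisfies \<open>D (p * w + j) = x\<^sub>j * D w\<close>. A coefficient
  of \<open>D z\<close> is therefore either zero or a coefficient, of degree one less, of \<open>D\<close> at the shifted
  point; by induction on the degree all coefficients vanish (\<open>Zp_mfps_eq_0\<close>).

  With the additional variables \<open>b\<^sub>0, \<dots>, b\<^bsub>p-1\<^esub>\<close> the same arguments apply to the coefficient of each
  monomial in the \<open>b\<^sub>i\<close>, because multiplication by \<open>a\<^sub>j\<close> acts on these coefficients separately. Only
  the \<open>p\<close> monomials \<open>b\<^sub>i\<close> occur, hence the sum is polynomial in the \<open>b\<^sub>i\<close>.
\<close>

section \<open>Splitting off the lowest digit\<close>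

lemma Zp_affine_Suc:
  assumes "w \<in> carrier (Zp p)" and "j < p"
  shows "Zp_affine p j w (Suc n) = p * w n + j"
proof -
  have "Zp_affine p j w (Suc n) = (p * w (Suc n) + j) mod (p * p ^ n)"
    by (simp add: Zp_affine_apply)
  also have "\<dots> = p * (w (Suc n) mod p ^ n) + j"
    using assms(2) by (subst mod_mult2_eq) simp
  finally show ?thesis
    using assms(1) by (simp add: Zp_carrier_iff)
qed

lemma Zp_shift_affine:
  assumes "w \<in> carrier (Zp p)" and "j < p"
  shows "Zp_shift p (Zp_affine p j w) = w"
proof -
  have "Zp_shift p (Zp_affine p j w) = (\<lambda>n. Zp_affine p j w (Suc n) div p)"
    using assms by (intro Zp_shift_spec(3) Zp_affine_closed) auto
  then show ?thesis
    using assms by (simp add: Zp_affine_Suc fun_eq_iff)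
qed

lemma Zp_affine_cases:
  assumes "0 < p" and z: "z \<in> carrier (Zp p)"
  obtains j w where "j < p" and "w \<in> carrier (Zp p)" and "z = Zp_affine p j w"
proof -
  interpret cring "Zp p" by (rule Zp_cring[OF assms(1)])
  let ?w = "\<lambda>n. z (Suc n) div p" and ?c = "Zp_of_nat p (Zp_trunc z 1)"
  note w = Zp_shift_spec(1,2)[OF assms]
  have c: "?c \<in> carrier (Zp p)" "Zp_of_nat p p \<in> carrier (Zp p)"
    by (simp_all add: Zp_of_nat_closed assms(1))
  have "Zp_affine p (Zp_trunc z 1) ?w = (z \<ominus>\<^bsub>Zp p\<^esub> ?c) \<oplus>\<^bsub>Zp p\<^esub> ?c"
    by (simp only: Zp_affine_def w(2))
  also have "\<dots> = z"
    using c z by (simp add: a_minus_def a_assoc l_neg)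
  finally have "z = Zp_affine p (Zp_trunc z 1) ?w" by simp
  moreover have "Zp_trunc z 1 < p"
    using z by (auto simp: Zp_trunc_def Zp_carrier_iff dest: spec[where x = 1])
  ultimately show thesis
    using that w(1) by blast
qed

text \<open>
  The digit \<open>k = 0\<close> is excluded because of the infinitely many leading zeros: \<open>digit_count p 0\<close> is
  the \<open>card\<close> of an infinite set, hence constantly \<open>0\<close>.
\<close>

lemma digit_count_step:
  assumes "2 \<le> p" and "0 < k" and "j < p"
  shows "digit_count p k (p * m + j) = digit_count p k m + (if k = j then 1 else 0)"
proof -
  let ?D = "\<lambda>m. {i. m div p ^ i mod p = k}"
  \<comment> \<open>The number \<open>m\<close> has at most \<open>m\<close> digits, so only finitely many of them equal \<open>k\<close>.\<close>
  have "m < p ^ m"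
    using assms(1) by (intro less_exp[THEN less_le_trans] power_mono) auto
  moreover have "p ^ m \<le> p ^ i" if "m \<le> i" for i
    using that assms(1) by (intro power_increasing) auto
  ultimately have "m div p ^ i = 0" if "m \<le> i" for i
    using that by (meson div_less less_le_trans)
  then have "i < m" if "i \<in> ?D m" for i
    using that assms(2) by (intro not_le_imp_less notI) simp
  then have fin: "finite (?D m)"
    by (intro finite_subset[OF _ finite_lessThan[of m]]) auto
  have split: "i \<in> ?D (p * m + j) \<longleftrightarrow> (i = 0 \<and> k = j) \<or> i \<in> Suc ` ?D m" for i
  proof (cases i)
    case (Suc l)
    then show ?thesis
      using assms by (auto simp: div_mult2_eq)
  qed (use assms in auto)
  have "?D (p * m + j) = (if k = j then insert 0 (Suc ` ?D m) else Suc ` ?D m)"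
    using split by (auto split: if_splits)
  then show ?thesis
    using fin by (auto simp: digit_count_def card_image)
qed

text \<open>
  For \<open>j \<noteq> 0\<close> the new digit adds one factor \<open>x\<^sub>j\<close> to the product and leaves the exponent of \<open>x\<^sub>0\<close>
  alone; for \<open>j = 0\<close> it raises that exponent by one. The bound on \<open>m\<close> ensures that the exponent
  is not a truncated difference, without which the second case would fail.
\<close>

lemma digit_monomial_step:
  assumes p: "2 \<le> p" and j: "j < p" and m: "m < p ^ n"
  shows "digit_monomial p x (Suc n) (p * m + j) = x j * digit_monomial p x n m"
proof -
  let ?K = "{1..p - 1}"
  let ?c = "\<lambda>k. digit_count p k m" and ?e = "\<lambda>k. if k = j then 1 else (0::nat)"
  have c: "digit_count p k (p * m + j) = ?c k + ?e k" if "k \<in> ?K" for k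
    using digit_count_step[OF p _ j] that by simp
  have sum: "(\<Sum>k\<in>?K. digit_count p k (p * m + j)) = (\<Sum>k\<in>?K. ?c k) + (\<Sum>k\<in>?K. ?e k)"
    by (simp only: sum.cong[OF refl c] sum.distrib)
  have prod: "(\<Prod>k\<in>?K. x k ^ digit_count p k (p * m + j)) =
      (\<Prod>k\<in>?K. x k ^ ?c k) * (\<Prod>k\<in>?K. x k ^ ?e k)"
    by (simp add: c power_add prod.distrib)
  have e: "(\<Prod>k\<in>?K. x k ^ ?e k) = (\<Prod>k\<in>?K. if k = j then x k else 1)"
    by (rule prod.cong) auto
  show ?thesis
  proof (cases "j = 0")
    case True
    then have "(\<Sum>k\<in>?K. ?e k) = 0" "(\<Prod>k\<in>?K. x k ^ ?e k) = 1"
      by auto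
    then show ?thesis
      unfolding digit_monomial_def sum prod
      using True sum_digit_count_le[OF m] by (simp add: Suc_diff_le mult.assoc)
  next
    case False
    then have "(\<Sum>k\<in>?K. ?e k) = 1" "(\<Prod>k\<in>?K. x k ^ ?e k) = x j"
      using j unfolding e by auto
    then show ?thesis
      unfolding digit_monomial_def sum prod by (simp add: mult_ac)
  qed
qed

lemma digit_monomial_0: "digit_monomial p x 0 0 = 1"
proof -
  have "digit_count p k 0 = 0" if "k \<in> {1..p - 1}" for k
    using that by (simp add: digit_count_def)
  then show ?thesis by (simp add: digit_monomial_def)
qed

lemma F_term_0:
  assumes "z \<in> carrier (Zp p)"
  shows "F_term p z 0 = 1"
proof -
  have "z 0 = 0" using assms by (auto simp: Zp_carrier_iff dest: spec[where x = 0])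
  then show ?thesis by (simp add: F_term_def Zp_trunc_def digit_monomial_0)
qed

lemma F_term_affine:
  assumes "2 \<le> p" and "j < p" and "w \<in> carrier (Zp p)"
  shows "F_term p (Zp_affine p j w) (Suc n) = mfps_var j * F_term p w n"
  using assms
  by (simp add: F_term_def Zp_trunc_def Zp_affine_Suc digit_monomial_step Zp_carrier_iff)


section \<open>Homogeneous power series and multiplication by a variable\<close>

definition expt_degree :: "(nat \<Rightarrow>\<^sub>0 nat) \<Rightarrow> nat" where
  "expt_degree m = (\<Sum>i. Poly_Mapping.lookup m i)"

lemma expt_degree_0: "expt_degree 0 = 0"
  by (simp add: expt_degree_def)

lemma expt_degree_single_add: "expt_degree (Poly_Mapping.single j (Suc 0) + m) = Suc (expt_degree m)"
proof -
  have "expt_degree (Poly_Mapping.single j (Suc 0) + m) =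
      (\<Sum>i. Poly_Mapping.lookup (Poly_Mapping.single j (Suc 0)) i) + expt_degree m"
    by (simp add: expt_degree_def lookup_add Sum_any.distrib)
  also have "(\<Sum>i. Poly_Mapping.lookup (Poly_Mapping.single j (Suc 0)) i) = 1"
    by (simp add: lookup_single)
  finally show ?thesis by simp
qed

lemma mfps_coeff_simps [simp]:
  "mfps_coeff 0 m = 0"
  "mfps_coeff 1 m = (if m = 0 then 1 else 0)"
  "mfps_coeff (f + g) m = mfps_coeff f m + mfps_coeff g m"
  "mfps_coeff (f - g) m = mfps_coeff f m - mfps_coeff g m"
  by (simp_all add: zero_mfps.rep_eq one_mfps.rep_eq plus_mfps.rep_eq minus_mfps.rep_eq)

lemma mfps_coeff_mult:
  "mfps_coeff (f * g) m = (\<Sum>(s, t) | s + t = m. mfps_coeff f s * mfps_coeff g t)"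
  by (simp add: times_mfps.rep_eq)

lemma mfps_coeff_sum: "mfps_coeff (\<Sum>n\<in>A. f n) m = (\<Sum>n\<in>A. mfps_coeff (f n) m)"
  by (induction A rule: infinite_finite_induct) simp_all

text \<open>
  Multiplication by the variable of index \<open>j\<close> merely moves coefficients from exponent \<open>t\<close> to
  \<open>single j 1 + t\<close>. Together with the following case distinction on exponents, this replaces all
  computation with the convolution product.
\<close>

lemma expt_cases:
  obtains "Poly_Mapping.lookup m j = 0" | t where "m = Poly_Mapping.single j (Suc 0) + t"
proof (cases "Poly_Mapping.lookup m j = 0")
  case False
  have "m = Poly_Mapping.single j (Suc 0) + (m - Poly_Mapping.single j (Suc 0))"
    by (rule poly_mapping_eqI)
      (use False in \<open>auto simp: lookup_add lookup_minus lookup_single when_def\<close>)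
  then show thesis by (rule that(2))
qed (rule that(1))

lemma mfps_coeff_var_mult:
  "mfps_coeff (mfps_var j * f) (Poly_Mapping.single j (Suc 0) + t) = mfps_coeff f t"
proof -
  let ?m = "Poly_Mapping.single j (Suc 0) + t" and ?v = "mfps_var j :: 'a mfps"
  have "mfps_coeff (?v * f) ?m = (\<Sum>(s, u) | s + u = ?m. mfps_coeff ?v s * mfps_coeff f u)"
    by (rule mfps_coeff_mult)
  also have "\<dots> = (\<Sum>(s, u)\<in>{(Poly_Mapping.single j (Suc 0), t)}. mfps_coeff ?v s * mfps_coeff f u)"
    by (rule sum.mono_neutral_right)
      (auto simp: finite_exponent_splits mfps_var.rep_eq split: if_splits)
  finally show ?thesis by (simp add: mfps_var.rep_eq)
qed

lemma mfps_coeff_var_mult_0: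
  assumes "Poly_Mapping.lookup m j = 0"
  shows "mfps_coeff (mfps_var j * f) m = 0"
proof -
  let ?v = "mfps_var j :: 'a mfps"
  have "mfps_coeff (?v * f) m = (\<Sum>(s, u) | s + u = m. mfps_coeff ?v s * mfps_coeff f u)"
    by (rule mfps_coeff_mult)
  also have "\<dots> = 0"
    using assms by (intro sum.neutral) (auto simp: mfps_var.rep_eq lookup_add)
  finally show ?thesis .
qed

lemma mfps_ring_closed:
  shows mfps_ring_0: "0 \<in> mfps_ring p"
    and mfps_ring_1: "1 \<in> mfps_ring p"
    and mfps_ring_add: "f \<in> mfps_ring p \<Longrightarrow> g \<in> mfps_ring p \<Longrightarrow> f + g \<in> mfps_ring p"
  unfolding mfps_ring_def by auto (metis add_0 lessThan_iff subsetD)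

lemma mfps_ring_sum: "(\<And>n. n \<in> A \<Longrightarrow> f n \<in> mfps_ring p) \<Longrightarrow> (\<Sum>n\<in>A. f n) \<in> mfps_ring p"
  by (induction A rule: infinite_finite_induct) (auto intro: mfps_ring_closed)

lemma mfps_ring_var_mult:
  assumes "j < p" and "f \<in> mfps_ring p"
  shows "mfps_var j * f \<in> mfps_ring p"
  unfolding mfps_ring_def
proof (intro CollectI allI impI)
  fix m assume m: "mfps_coeff (mfps_var j * f) m \<noteq> 0"
  show "Poly_Mapping.keys m \<subseteq> {..<p}"
  proof (cases m j rule: expt_cases)
    case 1
    then show ?thesis using m by (simp add: mfps_coeff_var_mult_0)
  next
    case (2 t)
    then have "Poly_Mapping.keys t \<subseteq> {..<p}"
      using m assms(2) by (simp add: mfps_coeff_var_mult mfps_ring_def)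
    moreover have "Poly_Mapping.keys m \<subseteq> insert j (Poly_Mapping.keys t)"
      using keys_add[of "Poly_Mapping.single j (Suc 0)" t] 2 by simp
    ultimately show ?thesis using assms(1) by auto
  qed
qed

definition mfps_homogeneous :: "nat \<Rightarrow> 'a::comm_ring_1 mfps \<Rightarrow> bool" where
  "mfps_homogeneous d f \<longleftrightarrow> (\<forall>m. mfps_coeff f m \<noteq> 0 \<longrightarrow> expt_degree m = d)"

lemma mfps_homogeneous_var_mult:
  assumes "mfps_homogeneous d f"
  shows "mfps_homogeneous (Suc d) (mfps_var j * f)"
  unfolding mfps_homogeneous_def
proof (intro allI impI)
  fix m assume m: "mfps_coeff (mfps_var j * f) m \<noteq> 0"
  show "expt_degree m = Suc d"
    using m assms
    by (cases m j rule: expt_cases)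
      (auto simp: mfps_coeff_var_mult mfps_coeff_var_mult_0 expt_degree_single_add
        mfps_homogeneous_def)
qed

text \<open>The coefficient of the limit at \<open>m\<close> can only come from the term whose index is the degree
  of \<open>m\<close>.\<close>

lemma mfps_sums_homogeneous:
  assumes "\<And>n. mfps_homogeneous n (f n)"
  obtains S where "mfps_sums f S"
proof
  show "mfps_sums f (Abs_mfps (\<lambda>m. mfps_coeff (f (expt_degree m)) m))"
    unfolding mfps_sums_def
  proof
    fix m
    have "mfps_coeff (\<Sum>n<N. f n) m = mfps_coeff (f (expt_degree m)) m"
      if "expt_degree m < N" for N
    proof -
      have "(\<Sum>n<N. mfps_coeff (f n) m) = (\<Sum>n\<in>{expt_degree m}. mfps_coeff (f n) m)"
        using that assms by (intro sum.mono_neutral_right) (auto simp: mfps_homogeneous_def)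
      then show ?thesis by (simp add: mfps_coeff_sum)
    qed
    then show "\<forall>\<^sub>F N in sequentially. mfps_coeff (\<Sum>n<N. f n) m =
        mfps_coeff (Abs_mfps (\<lambda>m. mfps_coeff (f (expt_degree m)) m)) m"
      by (auto simp: Abs_mfps_inverse intro: eventually_mono[OF eventually_gt_at_top])
  qed
qed

lemma mfps_sums_0: "mfps_sums (\<lambda>n. 0) 0"
  by (simp add: mfps_sums_def)

text \<open>Each coefficient of the limit already occurs in a partial sum.\<close>

lemma mfps_sums_in_ring:
  assumes S: "mfps_sums f S" and f: "\<And>n. f n \<in> mfps_ring p"
  shows "S \<in> mfps_ring p"
  unfolding mfps_ring_def
proof (intro CollectI allI impI)
  fix m assume m: "mfps_coeff S m \<noteq> 0"
  obtain N where "mfps_coeff (\<Sum>n<N. f n) m = mfps_coeff S m"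
    using S eventually_happens'[OF sequentially_bot] unfolding mfps_sums_def by blast
  moreover have "(\<Sum>n<N. f n) \<in> mfps_ring p"
    using f by (rule mfps_ring_sum)
  ultimately show "Poly_Mapping.keys m \<subseteq> {..<p}"
    using m by (simp add: mfps_ring_def)
qed

lemma mfps_sums_var_mult:
  assumes "mfps_sums f S"
  shows "mfps_sums (\<lambda>n. mfps_var j * f n) (mfps_var j * S)"
  unfolding mfps_sums_def sum_distrib_left[symmetric]
proof
  fix m
  show "\<forall>\<^sub>F N in sequentially.
      mfps_coeff (mfps_var j * (\<Sum>n<N. f n)) m = mfps_coeff (mfps_var j * S) m"
    using assms
    by (cases m j rule: expt_cases)
      (simp_all add: mfps_coeff_var_mult mfps_coeff_var_mult_0 mfps_sums_def)
qed

lemma mfps_sums_Suc: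
  assumes "mfps_sums (\<lambda>n. f (Suc n)) S"
  shows "mfps_sums f (S + f 0)"
  unfolding mfps_sums_def
proof
  fix m
  have "\<forall>\<^sub>F N in sequentially. mfps_coeff (\<Sum>n<Suc N. f n) m = mfps_coeff (S + f 0) m"
    using assms[unfolded mfps_sums_def, rule_format, of m]
    by eventually_elim (simp add: sum.lessThan_Suc_shift del: sum.lessThan_Suc)
  then show "\<forall>\<^sub>F N in sequentially. mfps_coeff (\<Sum>n<N. f n) m = mfps_coeff (S + f 0) m"
    by (simp only: eventually_sequentially_Suc[of "\<lambda>N. mfps_coeff (\<Sum>n<N. f n) m = mfps_coeff (S + f 0) m"])
qed

text \<open>
  The homogeneous version of the functional equation has only the zero solution: stripping the
  lowest digit off \<open>z\<close> strips one variable off the exponent of a nonzero coefficient, which can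
  only be repeated finitely often, whereas \<open>z\<close> never runs out of digits.
\<close>

lemma Zp_mfps_eq_0:
  assumes p: "0 < p" and z: "z \<in> carrier (Zp p)"
    and D: "\<And>z j. z \<in> carrier (Zp p) \<Longrightarrow> j < p \<Longrightarrow> D (Zp_affine p j z) = mfps_var j * D z"
  shows "D z = 0"
proof (rule mfps_eqI)
  fix m
  have "mfps_coeff (D z) m = 0"
    using z
  proof (induction "expt_degree m" arbitrary: z m rule: less_induct)
    case less
    obtain j w where w: "j < p" "w \<in> carrier (Zp p)" "z = Zp_affine p j w"
      using Zp_affine_cases[OF p less.prems] .
    show ?case
    proof (cases m j rule: expt_cases)
      case 1
      then show ?thesis by (simp add: w D mfps_coeff_var_mult_0)
    next
      case (2 t)
      then have "mfps_coeff (D z) m = mfps_coeff (D w) t"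
        by (simp add: w D mfps_coeff_var_mult)
      then show ?thesis
        using less.hyps[of t w] w(2) 2 by (simp add: expt_degree_single_add)
    qed
  qed
  then show "mfps_coeff (D z) m = mfps_coeff 0 m" by simp
qed


section \<open>The series in one family of variables\<close>

lemma F_term_homogeneous:
  assumes "2 \<le> p" and "z \<in> carrier (Zp p)"
  shows "mfps_homogeneous n (F_term p z n :: 'a::comm_ring_1 mfps) \<and>
    (F_term p z n :: 'a mfps) \<in> mfps_ring p"
  using assms(2)
proof (induction n arbitrary: z)
  case 0
  then show ?case
    by (simp add: F_term_0 mfps_ring_1 mfps_homogeneous_def expt_degree_0)
next
  case (Suc n)
  obtain j w where w: "j < p" "w \<in> carrier (Zp p)" "z = Zp_affine p j w"
    using Zp_affine_cases[of p z] assms(1) Suc.prems by auto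
  then show ?case
    using Suc.IH[of w] assms(1)
    by (simp add: F_term_affine mfps_homogeneous_var_mult mfps_ring_var_mult)
qed

lemma F_series_sums:
  assumes "2 \<le> p" and "z \<in> carrier (Zp p)"
  shows "mfps_sums (F_term p z) (F_series p z)"
proof -
  obtain S :: "'a mfps" where S: "mfps_sums (F_term p z) S"
    using mfps_sums_homogeneous[of "F_term p z"] F_term_homogeneous[OF assms] by blast
  then show ?thesis
    unfolding F_series_def mfps_suminf_def by (rule theI) (rule mfps_sums_unique[OF _ S])
qed

lemma F_series_solution:
  assumes p: "2 \<le> p"
  shows "F_solution p (F_series p)"
proof -
  have "F_series p (Zp_affine p j z) = mfps_var j * F_series p z + 1"
    if z: "z \<in> carrier (Zp p)" and j: "j < p" for z j
  proof -
    have closed: "Zp_affine p j z \<in> carrier (Zp p)"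
      using p z by (simp add: Zp_affine_closed)
    have "mfps_sums (\<lambda>n. F_term p (Zp_affine p j z) (Suc n)) (mfps_var j * F_series p z)"
      using mfps_sums_var_mult[OF F_series_sums[OF p z]] by (simp add: F_term_affine p j z)
    from mfps_sums_Suc[OF this] show ?thesis
      using F_series_sums[OF p closed] mfps_sums_unique by (auto simp: F_term_0 closed)
  qed
  moreover have "F_series p z \<in> mfps_ring p" if "z \<in> carrier (Zp p)" for z
    using F_series_sums[OF p that] F_term_homogeneous[OF p that] mfps_sums_in_ring by blast
  moreover have "{0..p - 1} = {..<p}" using p by auto
  ultimately show ?thesis
    unfolding F_solution_def by auto
qed

lemma F_solution_unique:
  assumes p: "2 \<le> p" and X: "F_solution p X" and Y: "F_solution p Y" and z: "z \<in> carrier (Zp p)"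
  shows "X z = Y z"
proof -
  have "X z - Y z = 0"
    by (rule Zp_mfps_eq_0[of p z "\<lambda>z. X z - Y z"])
      (use p X Y z in \<open>auto simp: F_solution_def algebra_simps\<close>)
  then show ?thesis by simp
qed


section \<open>The series with additional variables\<close>

lemma lookup_single_0_mult:
  "Poly_Mapping.lookup (Poly_Mapping.single 0 c * P) m = c * Poly_Mapping.lookup P (m :: nat \<Rightarrow>\<^sub>0 nat)"
  by (simp add: mult_map_scale_conv_mult[symmetric] map.rep_eq when_def)

lemma lookup_a_var_mult:
  "Poly_Mapping.lookup (a_var j * P) m = mfps_var j * Poly_Mapping.lookup P m"
  by (simp add: a_var_def lookup_single_0_mult)

text \<open>Both sides obey the recursion on the lowest digit, the map \<open>single 0\<close> being multiplicative.\<close>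

lemma digit_monomial_a_var:
  assumes "2 \<le> p" and "m < p ^ n"
  shows "digit_monomial p a_var n m = Poly_Mapping.single 0 (digit_monomial p mfps_var n m)"
  using assms(2)
proof (induction n arbitrary: m)
  case 0
  then show ?case by (simp add: digit_monomial_0)
next
  case (Suc n)
  have q: "m div p < p ^ n"
    using Suc.prems assms(1) by (simp add: less_mult_imp_div_less mult.commute)
  have r: "m mod p < p" using assms(1) by simp
  note step = digit_monomial_step[OF assms(1) r q, unfolded mult_div_mod_eq]
  show ?case
    unfolding step Suc.IH[OF q] by (simp add: a_var_def mult_single)
qed

lemma F_term_ab_eq:
  assumes "2 \<le> p" and "z \<in> carrier (Zp p)"
  shows "F_term_ab p z n =
    Poly_Mapping.single (Poly_Mapping.single (Zp_trunc ((Zp_shift p ^^ n) z) 1) 1) (F_term p z n)"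
  using assms
  by (simp add: F_term_ab_def F_term_def digit_monomial_a_var Zp_trunc_def Zp_carrier_iff
      b_var_def mult_single)

lemma F_term_ab_0:
  assumes "z \<in> carrier (Zp p)"
  shows "F_term_ab p z 0 = b_var (Zp_trunc z 1)"
proof -
  have "z 0 = 0" using assms by (auto simp: Zp_carrier_iff dest: spec[where x = 0])
  then show ?thesis by (simp add: F_term_ab_def Zp_trunc_def digit_monomial_0)
qed

lemma F_term_ab_affine:
  assumes "2 \<le> p" and "j < p" and "w \<in> carrier (Zp p)"
  shows "F_term_ab p (Zp_affine p j w) (Suc n) = a_var j * F_term_ab p w n"
proof -
  have "Zp_affine p j w \<in> carrier (Zp p)"
    using assms by (simp add: Zp_affine_closed)
  then show ?thesis
    using assms
    by (simp add: F_term_ab_eq F_term_affine funpow_Suc_right Zp_shift_affine a_var_def mult_single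
        del: funpow.simps)
qed

lemma Zp_shift_funpow_closed:
  assumes "0 < p" and "z \<in> carrier (Zp p)"
  shows "(Zp_shift p ^^ n) z \<in> carrier (Zp p)"
  using Zp_shift_spec(1,3)[OF assms(1)] assms(2) by (induction n) auto

text \<open>
  A coefficientwise limit of polynomials need not be a polynomial. Here it is one because the
  exponents of all terms lie in the finite set \<open>J\<close>.
\<close>

lemma mfps_poly_sums_single:
  assumes J: "finite J" and d: "\<And>n. d n \<in> J"
    and f: "\<And>n. mfps_homogeneous n (f n)"
  obtains S where "mfps_poly_sums (\<lambda>n. Poly_Mapping.single (d n) (f n)) S"
    and "Poly_Mapping.keys S \<subseteq> J"
proof -
  let ?g = "\<lambda>m n. Poly_Mapping.lookup (Poly_Mapping.single (d n) (f n)) m"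
  have "mfps_homogeneous n (?g m n)" for m n
    using f[of n] by (simp add: lookup_single when_def mfps_homogeneous_def)
  then have "\<exists>T. mfps_sums (?g m) T" for m
    using mfps_sums_homogeneous[of "?g m"] by blast
  then obtain T where T: "\<And>m. mfps_sums (?g m) (T m)" by metis
  have T0: "T m = 0" if "m \<notin> J" for m
  proof -
    have "?g m = (\<lambda>n. 0)"
      using that d by (auto simp: lookup_single when_def fun_eq_iff)
    then show ?thesis
      using T[of m] mfps_sums_0 mfps_sums_unique by metis
  qed
  have "finite {m. T m \<noteq> 0}"
    using T0 by (intro finite_subset[OF subsetI J]) blast
  then have lookup: "Poly_Mapping.lookup (Abs_poly_mapping T) = T"
    by (simp add: Abs_poly_mapping_inverse)
  show thesis
  proof
    show "mfps_poly_sums (\<lambda>n. Poly_Mapping.single (d n) (f n)) (Abs_poly_mapping T)"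
      using T by (simp add: mfps_poly_sums_def lookup)
    show "Poly_Mapping.keys (Abs_poly_mapping T) \<subseteq> J"
      using T0 unfolding keys.rep_eq lookup by blast
  qed
qed

lemma F_series_ab_sums:
  assumes p: "2 \<le> p" and z: "z \<in> carrier (Zp p)"
  shows "mfps_poly_sums (F_term_ab p z) (F_series_ab p z :: 'a::comm_ring_1 mfps_poly)"
    and "F_series_ab p z \<in> (mfps_poly_ring p :: 'a mfps_poly set)"
proof -
  let ?d = "\<lambda>n. Zp_trunc ((Zp_shift p ^^ n) z) 1"
  let ?e = "\<lambda>i. Poly_Mapping.single i (1::nat)"
  have d: "?d n \<in> {..<p}" for n
    using Zp_shift_funpow_closed[of p z n] p z
    by (auto simp: Zp_trunc_def Zp_carrier_iff dest: spec[where x = 1])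
  have F: "F_term_ab p z = (\<lambda>n. Poly_Mapping.single (?e (?d n)) (F_term p z n :: 'a mfps))"
    using p z by (intro ext F_term_ab_eq)
  obtain S :: "'a mfps_poly" where S: "mfps_poly_sums (F_term_ab p z) S"
    and keys: "Poly_Mapping.keys S \<subseteq> ?e ` {..<p}"
    unfolding F
    by (rule mfps_poly_sums_single[of "?e ` {..<p}" "\<lambda>n. ?e (?d n)" "F_term p z :: nat \<Rightarrow> 'a mfps"])
      (use d F_term_homogeneous[OF p z] in auto)
  have eq: "F_series_ab p z = S"
    unfolding F_series_ab_def mfps_poly_suminf_def
    using S mfps_poly_sums_unique by (intro the_equality)
  show "mfps_poly_sums (F_term_ab p z) (F_series_ab p z :: 'a mfps_poly)"
    using S by (simp add: eq)
  have "Poly_Mapping.lookup S m \<in> mfps_ring p" for m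
  proof (rule mfps_sums_in_ring)
    show "mfps_sums (\<lambda>n. Poly_Mapping.lookup (F_term_ab p z n) m) (Poly_Mapping.lookup S m)"
      using S by (simp add: mfps_poly_sums_def)
    show "Poly_Mapping.lookup (F_term_ab p z n :: 'a mfps_poly) m \<in> mfps_ring p" for n
      using F_term_homogeneous[OF p z, where 'a = 'a, of n]
      by (simp add: F lookup_single when_def mfps_ring_0)
  qed
  then show "F_series_ab p z \<in> (mfps_poly_ring p :: 'a mfps_poly set)"
    using keys by (force simp: eq mfps_poly_ring_def)
qed

lemma F_series_ab_solution:
  assumes p: "2 \<le> p"
  shows "F_solution_ab p (F_series_ab p)"
proof -
  have "F_series_ab p (Zp_affine p j z) = a_var j * F_series_ab p z + b_var j"
    if z: "z \<in> carrier (Zp p)" and j: "j < p" for z j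
  proof -
    have closed: "Zp_affine p j z \<in> carrier (Zp p)"
      using p z by (simp add: Zp_affine_closed)
    have 0: "F_term_ab p (Zp_affine p j z) 0 = b_var j"
      using j by (simp add: F_term_ab_0 closed) (simp add: Zp_trunc_def Zp_affine_apply)
    have "mfps_poly_sums (F_term_ab p (Zp_affine p j z)) (a_var j * F_series_ab p z + b_var j)"
      unfolding mfps_poly_sums_def
    proof
      fix m
      have "mfps_sums (\<lambda>n. Poly_Mapping.lookup (F_term_ab p z n) m)
          (Poly_Mapping.lookup (F_series_ab p z) m)"
        using F_series_ab_sums(1)[OF p z] unfolding mfps_poly_sums_def by (rule spec)
      then have "mfps_sums (\<lambda>n. Poly_Mapping.lookup (F_term_ab p (Zp_affine p j z) (Suc n)) m)
          (mfps_var j * Poly_Mapping.lookup (F_series_ab p z) m)"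
        using mfps_sums_var_mult by (simp add: F_term_ab_affine p j z lookup_a_var_mult)
      from mfps_sums_Suc[OF this]
      show "mfps_sums (\<lambda>n. Poly_Mapping.lookup (F_term_ab p (Zp_affine p j z) n) m)
          (Poly_Mapping.lookup (a_var j * F_series_ab p z + b_var j) m)"
        by (simp add: 0 lookup_add lookup_a_var_mult)
    qed
    then show ?thesis
      using F_series_ab_sums(1)[OF p closed] mfps_poly_sums_unique by blast
  qed
  moreover have "{0..p - 1} = {..<p}" using p by auto
  ultimately show ?thesis
    using F_series_ab_sums(2)[OF p] unfolding F_solution_ab_def by auto
qed

lemma F_solution_ab_unique:
  assumes p: "2 \<le> p" and X: "F_solution_ab p X" and Y: "F_solution_ab p Y"
    and z: "z \<in> carrier (Zp p)"
  shows "X z = Y z"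
proof (rule poly_mapping_eqI)
  fix m
  let ?D = "\<lambda>z. Poly_Mapping.lookup (X z) m - Poly_Mapping.lookup (Y z) m"
  have "?D z = 0"
    by (rule Zp_mfps_eq_0[of p z ?D])
      (use p X Y z in \<open>auto simp: F_solution_ab_def lookup_add lookup_a_var_mult algebra_simps\<close>)
  then show "Poly_Mapping.lookup (X z) m = Poly_Mapping.lookup (Y z) m" by simp
qed

theorem theorem1:
  fixes p :: nat
  assumes "p \<ge> 2"
  shows
    "((\<forall>z \<in> carrier (Zp p). mfps_sums (F_term p z) (F_series p z :: 'a::idom mfps)) \<and>
      F_solution p (F_series p :: (nat \<Rightarrow> nat) \<Rightarrow> 'a mfps) \<and>
      (\<forall>Y :: (nat \<Rightarrow> nat) \<Rightarrow> 'a mfps.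
         F_solution p Y \<longrightarrow> (\<forall>z \<in> carrier (Zp p). Y z = F_series p z)))
     \<and>
     ((\<forall>z \<in> carrier (Zp p). mfps_poly_sums (F_term_ab p z) (F_series_ab p z :: 'a mfps_poly)) \<and>
      F_solution_ab p (F_series_ab p :: (nat \<Rightarrow> nat) \<Rightarrow> 'a mfps_poly) \<and>
      (\<forall>Y :: (nat \<Rightarrow> nat) \<Rightarrow> 'a mfps_poly.
         F_solution_ab p Y \<longrightarrow> (\<forall>z \<in> carrier (Zp p). Y z = F_series_ab p z)))"
  using F_series_sums[OF assms] F_series_solution[OF assms]
    F_solution_unique[OF assms _ F_series_solution[OF assms]]
    F_series_ab_sums(1)[OF assms] F_series_ab_solution[OF assms]
    F_solution_ab_unique[OF assms _ F_series_ab_solution[OF assms]]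
  by (intro conjI ballI allI impI)

end
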